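(* Let $k\ge 4$ be an even integer and let $G$ be a $2$-regular $k$-uniform hypergraph with $n$ vertices and $m$ edges, where $m$ is odd. Then $G$ is minimal non-odd-bipartite if and only if $G$ is connected and $G$ is isomorphic to a hypergraph obtained by the following construction (with these $k,m$ and $n=km/2$). Construction: for $t\in[m]$ let $V_t=\{\tfrac{k}{2}(t-1)+1,\dots,\tfrac{k}{2}t\}\subseteq[n]$. Let $K_{n,n}$ be the complete bipartite graph with parts $U_1=[n]$ and $U_2=\bigcup_{t=1}^m E_t$, where $E_t=\{e_t^1,\dots,e_t^{k/2}\}$ are pairwise disjoint sets of new symbols, and let $\hat K_{n,n}$ be obtained by deleting all edges between $V_t$ and $E_t$ for every $t\in[m]$. Choose a perfect matching $\hat M$ of $\hat K_{n,n}$, and let $W_t\subseteq[n]$ be the set of vertices matched to $E_t$ in $\hat M$, with the requirement that whenever $W_t=V_s$ for some $s\neq t$, one has $W_s\neq V_t$. The hypergraph has vertex set $[n]$ and edges $e_t=V_t\cup W_t$, $t\in[m]$.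
   Context: A hypergraph $G=(V,E)$ has a finite vertex set and an edge set of distinct nonempty subsets of $V$ (no multiple edges), with no isolated vertices. $G$ is $k$-uniform if every edge has $k$ vertices, and $d$-regular if every vertex lies in exactly $d$ edges. $G$ is connected if any two vertices are joined by a walk $v_0e_1v_1\dots e_tv_t$ with $\{v_{i-1},v_i\}\subseteq e_i$. For $k$ even, a $k$-uniform hypergraph $G$ is odd-bipartite if there is a bipartition $\{U,U^c\}$ of $V(G)$ such that every edge meets $U$ (and hence $U^c$) in an odd number of vertices. A $k$-uniform hypergraph ($k$ even) is minimal non-odd-bipartite if it is not odd-bipartite but $G-e$ (delete the edge $e$ from $E(G)$) is odd-bipartite for every edge $e$. *)

theory Defs
  imports Main
begin

definition hypergraph :: "'a set \<Rightarrow> 'a set set \<Rightarrow> bool" where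
  "hypergraph V E \<longleftrightarrow>
     finite V \<and> (\<forall>e\<in>E. e \<noteq> {} \<and> e \<subseteq> V) \<and> (\<forall>v\<in>V. \<exists>e\<in>E. v \<in> e)"

definition uniform :: "nat \<Rightarrow> 'a set set \<Rightarrow> bool" where
  "uniform k E \<longleftrightarrow> (\<forall>e\<in>E. card e = k)"

definition regular :: "nat \<Rightarrow> 'a set \<Rightarrow> 'a set set \<Rightarrow> bool" where
  "regular d V E \<longleftrightarrow> (\<forall>v\<in>V. card {e \<in> E. v \<in> e} = d)"

text \<open>The walk \<open>v\<^sub>0 e\<^sub>1 v\<^sub>1 \<dots> e\<^sub>t v\<^sub>t\<close> is given by \<open>vs = [v\<^sub>0, \<dots>, v\<^sub>t]\<close> and
  \<open>es = [e\<^sub>1, \<dots>, e\<^sub>t]\<close>; the trivial walk \<open>t = 0\<close> is allowed.\<close>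

definition walk :: "'a set \<Rightarrow> 'a set set \<Rightarrow> 'a list \<Rightarrow> 'a set list \<Rightarrow> bool" where
  "walk V E vs es \<longleftrightarrow>
     length vs = Suc (length es) \<and> set vs \<subseteq> V \<and> set es \<subseteq> E \<and>
     (\<forall>i<length es. {vs ! i, vs ! Suc i} \<subseteq> es ! i)"

definition hypergraph_connected :: "'a set \<Rightarrow> 'a set set \<Rightarrow> bool" where
  "hypergraph_connected V E \<longleftrightarrow>
     (\<forall>u\<in>V. \<forall>v\<in>V. \<exists>vs es. walk V E vs es \<and> hd vs = u \<and> last vs = v)"

definition odd_bipartite :: "'a set \<Rightarrow> 'a set set \<Rightarrow> bool" where
  "odd_bipartite V E \<longleftrightarrow> (\<exists>U\<subseteq>V. \<forall>e\<in>E. odd (card (e \<inter> U)))"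

definition minimal_non_odd_bipartite :: "'a set \<Rightarrow> 'a set set \<Rightarrow> bool" where
  "minimal_non_odd_bipartite V E \<longleftrightarrow>
     \<not> odd_bipartite V E \<and> (\<forall>e\<in>E. odd_bipartite V (E - {e}))"

definition hypergraph_isomorphic ::
    "'a set \<Rightarrow> 'a set set \<Rightarrow> 'b set \<Rightarrow> 'b set set \<Rightarrow> bool" where
  "hypergraph_isomorphic V E V' E' \<longleftrightarrow>
     (\<exists>f. bij_betw f V V' \<and> (\<lambda>e. f ` e) ` E = E')"

definition perfect_matching :: "'a set \<Rightarrow> 'a set set \<Rightarrow> 'a set set \<Rightarrow> bool" where
  "perfect_matching V E M \<longleftrightarrow> M \<subseteq> E \<and> (\<forall>v\<in>V. \<exists>!e. e \<in> M \<and> v \<in> e)"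

definition complete_bipartite_edges :: "'a set \<Rightarrow> 'b set \<Rightarrow> ('a + 'b) set set" where
  "complete_bipartite_edges A B = {{Inl a, Inr b} | a b. a \<in> A \<and> b \<in> B}"

definition V_block :: "nat \<Rightarrow> nat \<Rightarrow> nat set" where
  "V_block k t = {k div 2 * (t - 1) + 1 .. k div 2 * t}"

text \<open>The symbol \<open>e\<^sub>t\<^sup>j\<close> is encoded as the pair \<open>(t, j)\<close>.\<close>

definition E_block :: "nat \<Rightarrow> nat \<Rightarrow> (nat \<times> nat) set" where
  "E_block k t = {(t, j) | j. j \<in> {1..k div 2}}"

definition K_verts :: "nat \<Rightarrow> nat \<Rightarrow> nat \<Rightarrow> (nat + nat \<times> nat) set" where
  "K_verts k m n = Inl ` {1..n} \<union> Inr ` (\<Union>t\<in>{1..m}. E_block k t)"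

definition K_hat_edges :: "nat \<Rightarrow> nat \<Rightarrow> nat \<Rightarrow> (nat + nat \<times> nat) set set" where
  "K_hat_edges k m n =
     complete_bipartite_edges {1..n} (\<Union>t\<in>{1..m}. E_block k t)
     - (\<Union>t\<in>{1..m}. complete_bipartite_edges (V_block k t) (E_block k t))"

definition W_block :: "nat \<Rightarrow> nat \<Rightarrow> (nat + nat \<times> nat) set set \<Rightarrow> nat \<Rightarrow> nat set" where
  "W_block k n M t = {i \<in> {1..n}. \<exists>x\<in>E_block k t. {Inl i, Inr x} \<in> M}"

definition constructed :: "nat \<Rightarrow> nat \<Rightarrow> nat \<Rightarrow> nat set \<Rightarrow> nat set set \<Rightarrow> bool" where
  "constructed k m n V E \<longleftrightarrow>
     n = k * m div 2 \<and>
     (\<exists>M. perfect_matching (K_verts k m n) (K_hat_edges k m n) M \<and>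
        (\<forall>s\<in>{1..m}. \<forall>t\<in>{1..m}.
           s \<noteq> t \<and> W_block k n M t = V_block k s \<longrightarrow> W_block k n M s \<noteq> V_block k t) \<and>
        V = {1..n} \<and>
        E = (\<lambda>t. V_block k t \<union> W_block k n M t) ` {1..m})"

end

theory Submission
  imports Defs
begin

text \<open>
  A 2-regular hypergraph is dual to a loopless multigraph whose nodes are the hyperedges and whose
  edges are the vertices. A bipartition in which every hyperedge is odd is a spanning subgraph of
  the dual with all degrees odd, which exists iff every component has an even number of nodes. So
  if the number of hyperedges is odd, minimal non-odd-bipartiteness just means connectedness. The
  construction encodes a balanced orientation of the dual: \<open>V\<^sub>t\<close> and \<open>W\<^sub>t\<close> are the edges leaving and
  entering the node \<open>t\<close>. Such an orientation exists because all degrees of the dual equal the even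
  number \<open>k\<close>, and the side condition on \<open>W\<^sub>t\<close>, \<open>V\<^sub>s\<close> says that the hyperedges are distinct.
\<close>

section \<open>Balanced orientations of even multigraphs\<close>

text \<open>
  The multigraph has edge set \<open>V\<close> and the ends of \<open>v\<close> are \<open>a v\<close> and \<open>b v\<close>; loops are allowed since
  the induction creates them. Two edges \<open>v\<close>, \<open>w\<close> sharing an end \<open>x\<close> are spliced into one edge that
  bypasses \<open>x\<close>, and an orientation of the spliced edge is pulled back to the path through \<open>x\<close>.
\<close>

lemma balanced_orientation:
  fixes a b :: "'a \<Rightarrow> 'b"
  assumes "finite V"
    and "\<And>x. even (\<Sum>v\<in>V. of_bool (a v = x) + of_bool (b v = x) :: int)"
  shows "\<exists>f g. (\<forall>v\<in>V. f v = a v \<and> g v = b v \<or> f v = b v \<and> g v = a v) \<and>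
    (\<forall>x. (\<Sum>v\<in>V. of_bool (f v = x) - of_bool (g v = x) :: int) = 0)"
  using assms
proof (induction "card V" arbitrary: V a b rule: less_induct)
  case less
  show ?case
  proof (cases "V = {}")
    case True
    then show ?thesis by simp
  next
    case False
    then obtain v where v: "v \<in> V" by blast
    have fin: "finite (V - {v})" and Vv: "V = insert v (V - {v})" "v \<notin> V - {v}"
      using less.prems(1) v by auto
    note sum_v = sum.insert[OF fin Vv(2), folded Vv(1)]
    show ?thesis
    proof (cases "a v = b v")
      case True
      \<comment> \<open>A loop counts twice at its node, so removing it preserves all
        parities.\<close>
      have ev: "even (\<Sum>u\<in>V - {v}. of_bool (a u = x) + of_bool (b u = x) :: int)" for x
        using less.prems(2)[of x] True by (simp add: sum_v)
      have "card (V - {v}) < card V"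
        using v less.prems(1) by (meson card_Diff1_less)
      from less.hyps[OF this fin ev] obtain f g where
        fg: "\<forall>u\<in>V - {v}. f u = a u \<and> g u = b u \<or> f u = b u \<and> g u = a u"
        and bal: "\<And>x. (\<Sum>u\<in>V - {v}. of_bool (f u = x) - of_bool (g u = x) :: int) = 0"
        by auto
      define f' g' where "f' = f(v := a v)" and "g' = g(v := a v)"
      have "(\<Sum>u\<in>V - {v}. of_bool (f' u = x) - of_bool (g' u = x) :: int) =
          (\<Sum>u\<in>V - {v}. of_bool (f u = x) - of_bool (g u = x))" for x
        by (rule sum.cong) (auto simp: f'_def g'_def)
      then have "\<forall>x. (\<Sum>u\<in>V. of_bool (f' u = x) - of_bool (g' u = x) :: int) = 0"
        using bal by (simp add: sum_v) (simp add: f'_def g'_def)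
      moreover have "\<forall>u\<in>V. f' u = a u \<and> g' u = b u \<or> f' u = b u \<and> g' u = a u"
        using fg True by (auto simp: f'_def g'_def)
      ultimately show ?thesis by blast
    next
      case False
      \<comment> \<open>Here \<open>v\<close> is not a loop and counts once at \<open>b v\<close>;
        evenness forces another edge there.\<close>
      have "\<exists>w\<in>V - {v}. a w = b v \<or> b w = b v"
      proof (rule ccontr)
        assume "\<not> ?thesis"
        then have "(\<Sum>u\<in>V - {v}. of_bool (a u = b v) + of_bool (b u = b v) :: int) = 0"
          by (intro sum.neutral) auto
        then show False
          using less.prems(2)[of "b v"] False by (simp add: sum_v)
      qed
      then obtain w where w: "w \<in> V" "w \<noteq> v" "a w = b v \<or> b w = b v" by auto
      \<comment> \<open>\<open>z\<close> is the far end of \<open>w\<close> seen from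
        \<open>b v\<close>; it equals \<open>b v\<close> when \<open>w\<close> is a loop.\<close>
      define z where "z = (if a w = b v then b w else a w)"
      have ends: "a w = b v \<and> b w = z \<or> a w = z \<and> b w = b v"
        using w(3) by (auto simp: z_def)
      define R where "R = V - {v, w}"
      have finR: "finite R" and VR: "V = insert v (insert w R)" "V - {w} = insert v R"
        and vR: "v \<notin> R" "w \<notin> R" "v \<notin> insert w R"
        using less.prems(1) v w by (auto simp: R_def)
      \<comment> \<open>The spliced edge keeps the name \<open>v\<close> and now joins
        \<open>a v\<close> to \<open>z\<close>, while \<open>w\<close> is dropped.\<close>
      define b' where "b' = b(v := z)"
      have ev: "even (\<Sum>u\<in>V - {w}. of_bool (a u = x) + of_bool (b' u = x) :: int)" for x
      proof -
        have "(\<Sum>u\<in>R. of_bool (a u = x) + of_bool (b' u = x) :: int) =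
            (\<Sum>u\<in>R. of_bool (a u = x) + of_bool (b u = x))"
          by (rule sum.cong) (use vR in \<open>auto simp: b'_def\<close>)
        then have "(\<Sum>u\<in>V - {w}. of_bool (a u = x) + of_bool (b' u = x) :: int) =
            of_bool (a v = x) + of_bool (z = x) + (\<Sum>u\<in>R. of_bool (a u = x) + of_bool (b u = x))"
          unfolding VR(2) using finR vR by (simp add: b'_def)
        \<comment> \<open>Splicing lowers the degree only at \<open>b v\<close>, and there by
          2.\<close>
        moreover have "(\<Sum>u\<in>V. of_bool (a u = x) + of_bool (b u = x) :: int) =
            of_bool (a v = x) + of_bool (z = x) + 2 * of_bool (b v = x) +
            (\<Sum>u\<in>R. of_bool (a u = x) + of_bool (b u = x))"
          unfolding VR(1) using finR vR ends by auto
        ultimately show ?thesis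
          using less.prems(2)[of x] by presburger
      qed
      have "card (V - {w}) < card V"
        using w less.prems(1) by (meson card_Diff1_less)
      from less.hyps[OF this _ ev] less.prems(1) obtain f g where
        fg: "\<forall>u\<in>V - {w}. f u = a u \<and> g u = b' u \<or> f u = b' u \<and> g u = a u"
        and bal: "\<And>x. (\<Sum>u\<in>V - {w}. of_bool (f u = x) - of_bool (g u = x) :: int) = 0"
        by auto
      have fgv: "f v = a v \<and> g v = z \<or> f v = z \<and> g v = a v"
        using bspec[OF fg, of v] v w(2) by (simp add: b'_def)
      \<comment> \<open>\<open>c\<close> says that the spliced edge runs from \<open>a v\<close> to
        \<open>z\<close>. The path is then \<open>v\<close> followed by \<open>w\<close>; otherwise
        it is traversed backwards. Either way the extra contributions at \<open>b v\<close>
        cancel.\<close>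
      define c where "c \<longleftrightarrow> f v = a v \<and> g v = z"
      define f' where "f' = f(v := if c then a v else b v, w := if c then b v else z)"
      define g' where "g' = g(v := if c then b v else a v, w := if c then z else b v)"
      have "(\<Sum>u\<in>V. of_bool (f' u = x) - of_bool (g' u = x) :: int) = 0" for x
      proof -
        have "(\<Sum>u\<in>R. of_bool (f' u = x) - of_bool (g' u = x) :: int) =
            (\<Sum>u\<in>R. of_bool (f u = x) - of_bool (g u = x))"
          by (rule sum.cong) (use vR in \<open>auto simp: f'_def g'_def\<close>)
        moreover have "of_bool (f v = x) - of_bool (g v = x) +
            (\<Sum>u\<in>R. of_bool (f u = x) - of_bool (g u = x) :: int) = 0"
          using bal[of x] finR vR unfolding VR(2) by simp
        moreover have "of_bool (f' v = x) - of_bool (g' v = x) + (of_bool (f' w = x) - of_bool (g' w = x)) =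
            (of_bool (f v = x) - of_bool (g v = x) :: int)"
          using fgv w(2) by (auto simp: f'_def g'_def c_def)
        ultimately show ?thesis
          unfolding VR(1) using finR vR by simp
      qed
      moreover have "\<forall>u\<in>V. f' u = a u \<and> g' u = b u \<or> f' u = b u \<and> g' u = a u"
      proof
        fix u assume "u \<in> V"
        then show "f' u = a u \<and> g' u = b u \<or> f' u = b u \<and> g' u = a u"
          using bspec[OF fg, of u] ends w(2) by (auto simp: f'_def g'_def b'_def)
      qed
      ultimately show ?thesis by blast
    qed
  qed
qed

section \<open>Splitting the hyperedges of a 2-regular hypergraph into halves\<close>

lemma regular_2_endsE:
  assumes "regular 2 V E"
  obtains a b where "\<And>v. v \<in> V \<Longrightarrow> {e \<in> E. v \<in> e} = {a v, b v}" "\<And>v. v \<in> V \<Longrightarrow> a v \<noteq> b v"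
proof -
  have "\<forall>v\<in>V. \<exists>p. {e \<in> E. v \<in> e} = {fst p, snd p} \<and> fst p \<noteq> snd p"
    using assms by (auto simp: regular_def card_2_iff)
  then obtain p where "\<forall>v\<in>V. {e \<in> E. v \<in> e} = {fst (p v), snd (p v)} \<and> fst (p v) \<noteq> snd (p v)"
    by metis
  then show ?thesis using that[of "fst \<circ> p" "snd \<circ> p"] by auto
qed

text \<open>In the dual multigraph the node \<open>e\<close> has degree \<open>card e = k\<close>. A
  balanced orientation has as many edges leaving as entering each node, hence \<open>k div 2\<close>
  of each; \<open>f v\<close> and \<open>g v\<close> are the tail and the head of the edge
  \<open>v\<close>.\<close>

lemma regular_2_balanced_split:
  fixes V :: "'a set"
  assumes "hypergraph V E" "regular 2 V E" "uniform k E" "even k"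
  obtains f g where "\<And>v. v \<in> V \<Longrightarrow> {e \<in> E. v \<in> e} = {f v, g v}" "\<And>v. v \<in> V \<Longrightarrow> f v \<noteq> g v"
    "\<And>e. e \<in> E \<Longrightarrow> card {v \<in> V. f v = e} = k div 2"
    "\<And>e. e \<in> E \<Longrightarrow> card {v \<in> V. g v = e} = k div 2"
proof -
  have fin: "finite V" and sub: "\<And>e. e \<in> E \<Longrightarrow> e \<subseteq> V"
    using assms(1) by (auto simp: hypergraph_def)
  obtain a b where ab: "\<And>v. v \<in> V \<Longrightarrow> {e \<in> E. v \<in> e} = {a v, b v}" "\<And>v. v \<in> V \<Longrightarrow> a v \<noteq> b v"
    using regular_2_endsE[OF assms(2)] by blast
  \<comment> \<open>Stated for any labelling of the two ends, to serve both for parity (with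
    \<open>a\<close>, \<open>b\<close>) and for the final count (with \<open>f\<close>,
    \<open>g\<close>).\<close>
  have deg: "(\<Sum>v\<in>V. of_bool (c v = e) + of_bool (d v = e) :: int) = int k"
    if cd: "\<And>v. v \<in> V \<Longrightarrow> {e \<in> E. v \<in> e} = {c v, d v}" "\<And>v. v \<in> V \<Longrightarrow> c v \<noteq> d v" and e: "e \<in> E"
    for c d e
  proof -
    have "(\<Sum>v\<in>V. of_bool (c v = e) + of_bool (d v = e) :: int) = (\<Sum>v\<in>V. of_bool (v \<in> e))"
    proof (rule sum.cong)
      fix v assume v: "v \<in> V"
      have "v \<in> e \<longleftrightarrow> e = c v \<or> e = d v"
        using cd(1)[OF v] e by blast
      then show "of_bool (c v = e) + of_bool (d v = e) = (of_bool (v \<in> e) :: int)"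
        using cd(2)[OF v] by auto
    qed simp
    also have "\<dots> = int (card (V \<inter> e))"
      using fin by (simp add: Int_def)
    also have "V \<inter> e = e" using sub[OF e] by blast
    finally show ?thesis using e assms(3) by (simp add: uniform_def)
  qed
  \<comment> \<open>Even degree is required at every value of the node type; sets outside
    \<open>E\<close> are isolated nodes.\<close>
  have "even (\<Sum>v\<in>V. of_bool (a v = e) + of_bool (b v = e) :: int)" for e
  proof (cases "e \<in> E")
    case True
    then show ?thesis using deg[OF ab True] assms(4) by simp
  next
    case False
    then have "(\<Sum>v\<in>V. of_bool (a v = e) + of_bool (b v = e) :: int) = 0"
      using ab(1) by (intro sum.neutral) auto
    then show ?thesis by simp
  qed
  from balanced_orientation[OF fin this] obtain f g where
    fg: "\<forall>v\<in>V. f v = a v \<and> g v = b v \<or> f v = b v \<and> g v = a v"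
    and bal: "\<And>e. (\<Sum>v\<in>V. of_bool (f v = e) - of_bool (g v = e) :: int) = 0"
    by auto
  have fg1: "\<And>v. v \<in> V \<Longrightarrow> {e \<in> E. v \<in> e} = {f v, g v}" and fg2: "\<And>v. v \<in> V \<Longrightarrow> f v \<noteq> g v"
  proof -
    fix v assume v: "v \<in> V"
    then show "{e \<in> E. v \<in> e} = {f v, g v}" "f v \<noteq> g v"
      using bspec[OF fg v] ab[OF v] by auto
  qed
  have "int (card {v \<in> V. f v = e}) + int (card {v \<in> V. g v = e}) = int k \<and>
      int (card {v \<in> V. f v = e}) - int (card {v \<in> V. g v = e}) = 0" if "e \<in> E" for e
    using deg[OF fg1 fg2 that] bal[of e] fin
    by (simp add: sum.distrib sum_subtractf Int_def)
  then have "card {v \<in> V. f v = e} = k div 2 \<and> card {v \<in> V. g v = e} = k div 2" if "e \<in> E" for e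
    using that by fastforce
  then show ?thesis using that fg1 fg2 by blast
qed

section \<open>Realising a balanced orientation by the construction\<close>

text \<open>Bijections between corresponding fibres glue because the target blocks are disjoint.
  This labels the vertices block by block, once by tails and once by heads.\<close>

lemma fibrewise_bij:
  assumes "finite V" and "\<And>v. v \<in> V \<Longrightarrow> p v \<in> I"
    and "\<And>i. i \<in> I \<Longrightarrow> finite (B i)"
    and "\<And>i. i \<in> I \<Longrightarrow> card {v \<in> V. p v = i} = card (B i)"
    and disj: "\<And>i j. i \<in> I \<Longrightarrow> j \<in> I \<Longrightarrow> i \<noteq> j \<Longrightarrow> B i \<inter> B j = {}"
  obtains h where "bij_betw h V (\<Union>i\<in>I. B i)" "\<And>i. i \<in> I \<Longrightarrow> h ` {v \<in> V. p v = i} = B i"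
proof -
  have "\<forall>i\<in>I. \<exists>h. bij_betw h {v \<in> V. p v = i} (B i)"
    using assms by (auto intro!: finite_same_card_bij)
  then obtain H where H: "\<And>i. i \<in> I \<Longrightarrow> bij_betw (H i) {v \<in> V. p v = i} (B i)"
    by metis
  define h where "h v = H (p v) v" for v
  have h: "bij_betw h {v \<in> V. p v = i} (B i)" if "i \<in> I" for i
    using H[OF that] by (rule iffD1[OF bij_betw_cong, rotated]) (auto simp: h_def)
  then have im: "h ` {v \<in> V. p v = i} = B i" if "i \<in> I" for i
    using that by (simp add: bij_betw_def)
  have V: "V = (\<Union>i\<in>I. {v \<in> V. p v = i})"
    using assms(2) by auto
  have "h ` V = (\<Union>i\<in>I. h ` {v \<in> V. p v = i})"
    using V by blast
  also have "\<dots> = (\<Union>i\<in>I. B i)"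
    using im by simp
  finally have "h ` V = (\<Union>i\<in>I. B i)" .
  moreover have "inj_on h V"
  proof (rule inj_onI)
    fix u v assume uv: "u \<in> V" "v \<in> V" "h u = h v"
    then have "h u \<in> B (p u)" "h u \<in> B (p v)"
      using im assms(2) by blast+
    then have "p u = p v" using disj assms(2) uv by blast
    then show "u = v"
      using h[of "p v"] assms(2) uv by (auto simp: bij_betw_def dest: inj_onD)
  qed
  ultimately show ?thesis
    using that[of h] im by (simp add: bij_betw_def)
qed

text \<open>The blocks are the fibres of division by \<open>k div 2\<close>, shifted because
  vertices and blocks count from 1. The condition \<open>x \<ge> 1\<close> excludes 0, which
  truncated subtraction would put into the first block.\<close>

lemma mem_V_block_iff:
  assumes "k div 2 > 0" "t \<ge> 1"
  shows "x \<in> V_block k t \<longleftrightarrow> x \<ge> 1 \<and> (x - 1) div (k div 2) = t - 1"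
proof -
  define h where "h = k div 2"
  obtain s where t: "t = Suc s" using assms(2) by (cases t) auto
  have h: "h > 0" using assms(1) by (simp add: h_def)
  have "(x - 1) div h = s \<longleftrightarrow> s \<le> (x - 1) div h \<and> (x - 1) div h < Suc s"
    by auto
  also have "\<dots> \<longleftrightarrow> s * h \<le> x - 1 \<and> x - 1 < Suc s * h"
    using h by (simp only: less_eq_div_iff_mult_less_eq div_less_iff_less_mult)
  finally have "(x - 1) div h = s \<longleftrightarrow> h * s \<le> x - 1 \<and> x - 1 < h * Suc s"
    by (simp only: mult.commute)
  then have "x \<ge> 1 \<and> (x - 1) div h = t - 1 \<longleftrightarrow> h * s + 1 \<le> x \<and> x \<le> h * Suc s"
    unfolding t by linarith
  then show ?thesis by (simp add: V_block_def t h_def)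
qed

lemma UN_V_block:
  assumes "k div 2 > 0"
  shows "(\<Union>t\<in>{1..m}. V_block k t) = {1..k div 2 * m}"
proof (rule set_eqI)
  fix x
  define h where "h = k div 2"
  have "x \<in> (\<Union>t\<in>{1..m}. V_block k t) \<longleftrightarrow> x \<ge> 1 \<and> (\<exists>t\<in>{1..m}. (x - 1) div h = t - 1)"
    using mem_V_block_iff[OF assms] by (auto simp: h_def)
  also have "\<dots> \<longleftrightarrow> x \<ge> 1 \<and> (x - 1) div h < m"
    by (auto intro!: bexI[of _ "Suc ((x - 1) div h)"])
  also have "\<dots> \<longleftrightarrow> x \<in> {1..h * m}"
    using assms by (auto simp: h_def[symmetric] div_less_iff_less_mult mult.commute)
  finally show "x \<in> (\<Union>t\<in>{1..m}. V_block k t) \<longleftrightarrow> x \<in> {1..k div 2 * m}"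
    by (simp add: h_def)
qed

text \<open>A balanced split dictates the construction: vertices with tail \<open>e\<close> fill the
  \<open>V_block\<close> of \<open>e\<close>, and those with head \<open>e\<close> receive the
  symbols of its \<open>E_block\<close>. Each vertex becomes the matching edge joining its number to
  its symbol.\<close>

lemma regular_2_isomorphic_constructed:
  fixes V :: "'a set"
  assumes k: "k \<ge> 2" "even k" and hyp: "hypergraph V E" and reg: "regular 2 V E"
    and uni: "uniform k E" and "card V = n" and "card E = m"
  shows "\<exists>V' E'. constructed k m n V' E' \<and> hypergraph_isomorphic V E V' E'"
proof -
  have k2: "k div 2 > 0" using k by auto
  have finV: "finite V" and sub: "\<And>e. e \<in> E \<Longrightarrow> e \<subseteq> V"
    using hyp by (auto simp: hypergraph_def)
  then have finE: "finite E"
    by (meson PowI finite_Pow_iff finite_subset subsetI)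
  obtain f g where fg: "\<And>v. v \<in> V \<Longrightarrow> {e \<in> E. v \<in> e} = {f v, g v}" "\<And>v. v \<in> V \<Longrightarrow> f v \<noteq> g v"
    and cf: "\<And>e. e \<in> E \<Longrightarrow> card {v \<in> V. f v = e} = k div 2"
    and cg: "\<And>e. e \<in> E \<Longrightarrow> card {v \<in> V. g v = e} = k div 2"
    using regular_2_balanced_split[OF hyp reg uni k(2)] by blast
  have fgE: "f v \<in> E" "g v \<in> E" if "v \<in> V" for v
    using fg(1)[OF that] by auto
  obtain \<iota> where \<iota>: "bij_betw \<iota> E {1..m}"
    using finite_same_card_bij[OF finE, of "{1..m}"] assms by auto
  have \<iota>I: "\<iota> e \<in> {1..m}" if "e \<in> E" for e
    using \<iota> that by (auto simp: bij_betw_def)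
  have \<iota>E: thesis if "t \<in> {1..m}" "\<And>e. e \<in> E \<Longrightarrow> \<iota> e = t \<Longrightarrow> thesis" for t thesis
  proof -
    have "t \<in> \<iota> ` E" using that(1) by (simp only: bij_betw_imp_surj_on[OF \<iota>])
    then show ?thesis using that(2) by auto
  qed
  have fibre: "card {v \<in> V. \<iota> (q v) = t} = k div 2"
    if t: "t \<in> {1..m}" and q: "\<And>v. v \<in> V \<Longrightarrow> q v \<in> E"
      and c: "\<And>e. e \<in> E \<Longrightarrow> card {v \<in> V. q v = e} = k div 2" for t q
  proof -
    obtain e where e: "e \<in> E" "\<iota> e = t" using \<iota>E[OF t] .
    have "{v \<in> V. \<iota> (q v) = t} = {v \<in> V. q v = e}"
      using e q \<iota> by (auto simp: bij_betw_def inj_on_def)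
    then show ?thesis using c[OF e(1)] by simp
  qed
  have disjV: "V_block k s \<inter> V_block k t = {}" if "s \<in> {1..m}" "t \<in> {1..m}" "s \<noteq> t" for s t
    using that mem_V_block_iff[OF k2, of s] mem_V_block_iff[OF k2, of t] by auto
  have cardV: "card (V_block k t) = k div 2" if "t \<in> {1..m}" for t
    using that by (cases t) (auto simp: V_block_def)
  have E_img: "E_block k t = Pair t ` {1..k div 2}" for t
    by (auto simp: E_block_def)
  have cardE: "card (E_block k t) = k div 2" for t
    by (simp add: E_img card_image inj_on_def)
  \<comment> \<open>\<open>\<phi>\<close> numbers the vertices according to their tails; it will be
    the isomorphism.\<close>
  obtain \<phi> where \<phi>: "bij_betw \<phi> V (\<Union>t\<in>{1..m}. V_block k t)"
    and \<phi>im: "\<And>t. t \<in> {1..m} \<Longrightarrow> \<phi> ` {v \<in> V. \<iota> (f v) = t} = V_block k t"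
  proof (rule fibrewise_bij[OF finV, of "\<lambda>v. \<iota> (f v)" "{1..m}" "V_block k"])
    show "card {v \<in> V. \<iota> (f v) = t} = card (V_block k t)" if "t \<in> {1..m}" for t
      using fibre[OF that, of f] fgE(1) cf cardV[OF that] by simp
  qed (use \<iota>I fgE disjV in \<open>auto simp: V_block_def\<close>)
  \<comment> \<open>\<open>\<psi>\<close> gives each vertex a symbol belonging to its head.\<close>
  obtain \<psi> where \<psi>: "bij_betw \<psi> V (\<Union>t\<in>{1..m}. E_block k t)"
    and \<psi>im: "\<And>t. t \<in> {1..m} \<Longrightarrow> \<psi> ` {v \<in> V. \<iota> (g v) = t} = E_block k t"
  proof (rule fibrewise_bij[OF finV, of "\<lambda>v. \<iota> (g v)" "{1..m}" "E_block k"])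
    show "card {v \<in> V. \<iota> (g v) = t} = card (E_block k t)" if "t \<in> {1..m}" for t
      using fibre[OF that, of g] fgE(2) cg cardE by simp
  qed (use \<iota>I fgE in \<open>auto simp: E_img\<close>)
  have "card V = card {1..k div 2 * m}"
    using bij_betw_same_card[OF \<phi>] unfolding UN_V_block[OF k2] .
  then have n: "n = k div 2 * m" using assms(6) by simp
  then have n': "n = k * m div 2" using k(2) by auto
  have UV: "(\<Union>t\<in>{1..m}. V_block k t) = {1..n}"
    using UN_V_block[OF k2] n by simp
  have \<phi>I: "\<phi> v \<in> {1..n}" if "v \<in> V" for v
    using bij_betw_apply[OF \<phi> that] unfolding UV .
  have \<phi>inj: "\<phi> u = \<phi> v \<longleftrightarrow> u = v" if "u \<in> V" "v \<in> V" for u v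
    using \<phi> that by (auto simp: bij_betw_def inj_on_def)
  have \<psi>inj: "\<psi> u = \<psi> v \<longleftrightarrow> u = v" if "u \<in> V" "v \<in> V" for u v
    using \<psi> that by (auto simp: bij_betw_def inj_on_def)
  have \<phi>V: "\<phi> v \<in> V_block k t \<longleftrightarrow> \<iota> (f v) = t" if "v \<in> V" "t \<in> {1..m}" for v t
    using that \<phi>inj by (auto simp flip: \<phi>im[OF that(2)])
  have \<psi>E: "\<psi> v \<in> E_block k t \<longleftrightarrow> \<iota> (g v) = t" if "v \<in> V" "t \<in> {1..m}" for v t
    using that \<psi>inj by (auto simp flip: \<psi>im[OF that(2)])
  define M where "M = (\<lambda>v. {Inl (\<phi> v), Inr (\<psi> v)}) ` V"
  have pm: "perfect_matching (K_verts k m n) (K_hat_edges k m n) M"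
    unfolding perfect_matching_def
  proof (intro conjI ballI)
    show "M \<subseteq> K_hat_edges k m n"
    proof
      fix d assume "d \<in> M"
      then obtain v where v: "v \<in> V" "d = {Inl (\<phi> v), Inr (\<psi> v)}" by (auto simp: M_def)
      have "\<psi> v \<in> (\<Union>t\<in>{1..m}. E_block k t)"
        using \<psi> v by (auto simp: bij_betw_def)
      then have "d \<in> complete_bipartite_edges {1..n} (\<Union>t\<in>{1..m}. E_block k t)"
        using \<phi>I[OF v(1)] v(2) unfolding complete_bipartite_edges_def by blast
      moreover have "d \<notin> complete_bipartite_edges (V_block k t) (E_block k t)" if t: "t \<in> {1..m}" for t
      proof
        assume "d \<in> complete_bipartite_edges (V_block k t) (E_block k t)"
        then have "\<phi> v \<in> V_block k t" "\<psi> v \<in> E_block k t"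
          using v(2) by (auto simp: complete_bipartite_edges_def doubleton_eq_iff)
        \<comment> \<open>A deleted edge would give \<open>v\<close> the same tail and head.\<close>
        then have "\<iota> (f v) = \<iota> (g v)" using \<phi>V[OF v(1) t] \<psi>E[OF v(1) t] by simp
        then show False
          using fg(2)[OF v(1)] fgE[OF v(1)] \<iota> by (auto simp: bij_betw_def inj_on_def)
      qed
      ultimately show "d \<in> K_hat_edges k m n" by (auto simp: K_hat_edges_def)
    qed
  next
    fix x assume "x \<in> K_verts k m n"
    then consider v where "v \<in> V" "x = Inl (\<phi> v)" | v where "v \<in> V" "x = Inr (\<psi> v)"
      using \<phi> \<psi> unfolding K_verts_def bij_betw_def UV by blast
    then show "\<exists>!d. d \<in> M \<and> x \<in> d"
    proof cases
      case (1 v)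
      then show ?thesis
        by (intro ex1I[of _ "{Inl (\<phi> v), Inr (\<psi> v)}"]) (auto simp: M_def \<phi>inj)
    next
      case (2 v)
      then show ?thesis
        by (intro ex1I[of _ "{Inl (\<phi> v), Inr (\<psi> v)}"]) (auto simp: M_def \<psi>inj)
    qed
  qed
  have W: "W_block k n M t = \<phi> ` {v \<in> V. \<iota> (g v) = t}" if t: "t \<in> {1..m}" for t
  proof -
    have "W_block k n M t = \<phi> ` {v \<in> V. \<psi> v \<in> E_block k t}"
      using \<phi>I by (auto simp: W_block_def M_def doubleton_eq_iff)
    then show ?thesis using \<psi>E[OF _ t] by (auto simp: image_def)
  qed
  \<comment> \<open>The vertices of a hyperedge are those leaving it together with those entering
    it.\<close>
  have VW: "V_block k (\<iota> e) \<union> W_block k n M (\<iota> e) = \<phi> ` e" if e: "e \<in> E" for e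
  proof -
    have "\<iota> (f v) = \<iota> e \<or> \<iota> (g v) = \<iota> e \<longleftrightarrow> v \<in> e" if v: "v \<in> V" for v
    proof -
      have "v \<in> e \<longleftrightarrow> f v = e \<or> g v = e" using fg(1)[OF v] e by blast
      then show ?thesis using \<iota> fgE[OF v] e by (auto simp: bij_betw_def inj_on_def)
    qed
    then have "{v \<in> V. \<iota> (f v) = \<iota> e} \<union> {v \<in> V. \<iota> (g v) = \<iota> e} = e"
      using sub[OF e] by blast
    then show ?thesis
      unfolding W[OF \<iota>I[OF e]] \<phi>im[OF \<iota>I[OF e], symmetric] image_Un[symmetric] by simp
  qed
  \<comment> \<open>If the two blocks were swapped, the two unions would agree, and injectivity of
    \<open>\<phi>\<close> would identify hyperedges with different numbers.\<close>
  have dist: "W_block k n M s \<noteq> V_block k t"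
    if s: "s \<in> {1..m}" and t: "t \<in> {1..m}" and st: "s \<noteq> t \<and> W_block k n M t = V_block k s" for s t
  proof
    assume *: "W_block k n M s = V_block k t"
    obtain d e where de: "d \<in> E" "s = \<iota> d" "e \<in> E" "t = \<iota> e"
      using \<iota>E[OF s] \<iota>E[OF t] by metis
    have "\<phi> ` d = \<phi> ` e"
      using VW[OF de(1)] VW[OF de(3)] * st de by (simp add: Un_commute)
    then have "d = e"
      using \<phi> sub de by (metis bij_betw_def inj_on_image_eq_iff)
    then show False using st de by simp
  qed
  define E' where "E' = (\<lambda>t. V_block k t \<union> W_block k n M t) ` {1..m}"
  have "constructed k m n {1..n} E'"
    unfolding constructed_def using n' pm dist E'_def by blast
  moreover have "(\<lambda>e. \<phi> ` e) ` E = E'"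
  proof -
    have "E' = (\<lambda>t. V_block k t \<union> W_block k n M t) ` \<iota> ` E"
      using \<iota> by (simp add: E'_def bij_betw_def)
    then show ?thesis using VW by (simp add: image_image)
  qed
  ultimately show ?thesis
    using \<phi> unfolding UV hypergraph_isomorphic_def by blast
qed

section \<open>Odd bipartitions and connectedness\<close>

text \<open>Count the incidences between \<open>F\<close> and \<open>U\<close> twice: by vertices
  the sum consists of even degrees, by edges of an odd number of odd terms.\<close>

lemma odd_card_not_odd_bipartite:
  assumes "finite V" "finite F" "odd (card F)" "\<And>e. e \<in> F \<Longrightarrow> e \<subseteq> V"
    and "\<And>v. v \<in> V \<Longrightarrow> even (card {e \<in> F. v \<in> e})"
  shows "\<not> odd_bipartite V F"
proof
  assume "odd_bipartite V F"
  then obtain U where U: "U \<subseteq> V" "\<And>e. e \<in> F \<Longrightarrow> odd (card (e \<inter> U))"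
    by (auto simp: odd_bipartite_def)
  have fU: "finite U" using U assms(1) finite_subset by blast
  have "(\<Sum>e\<in>F. card (e \<inter> U)) = (\<Sum>e\<in>F. \<Sum>v\<in>U. of_bool (v \<in> e))"
    using fU by (simp add: Int_def conj_commute)
  also have "\<dots> = (\<Sum>v\<in>U. \<Sum>e\<in>F. of_bool (v \<in> e))"
    by (rule sum.swap)
  also have "\<dots> = (\<Sum>v\<in>U. card {e \<in> F. v \<in> e})"
    using assms(2) by (simp add: Int_def)
  also have "even \<dots>"
    using U assms(5) by (intro dvd_sum) auto
  finally have "even (\<Sum>e\<in>F. card (e \<inter> U))" .
  moreover have "{e \<in> F. odd (card (e \<inter> U))} = F" using U by auto
  ultimately show False
    using assms(2,3) by (simp add: even_sum_iff)
qed

lemma walk_snoc: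
  assumes "walk V E vs es" "last vs \<in> e" "w \<in> e" "e \<in> E" "w \<in> V"
  shows "walk V E (vs @ [w]) (es @ [e])"
proof -
  have len: "length vs = Suc (length es)" using assms(1) by (simp add: walk_def)
  then have "last vs = vs ! length es" by (metis diff_Suc_1 last_conv_nth length_0_conv nat.distinct(1))
  then show ?thesis using assms len by (auto simp: walk_def nth_append less_Suc_eq)
qed

text \<open>Let \<open>C\<close> be the component of \<open>u\<close> and \<open>F\<close> the set
  of hyperedges inside it. Degrees in \<open>F\<close> and in \<open>E - F\<close> are 0 or 2, and
  exactly one of these families has odd size. Minimality makes that one all of \<open>E\<close>, and
  it must be \<open>F\<close>.\<close>

lemma minimal_non_odd_bipartite_imp_connected:
  assumes hyp: "hypergraph V E" and reg: "regular 2 V E" and odd: "odd (card E)"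
    and min: "minimal_non_odd_bipartite V E"
  shows "hypergraph_connected V E"
  unfolding hypergraph_connected_def
proof (intro ballI)
  fix u v assume u: "u \<in> V" and v: "v \<in> V"
  have finV: "finite V" and sub: "\<And>e. e \<in> E \<Longrightarrow> e \<subseteq> V \<and> e \<noteq> {}"
    and iso: "\<And>w. w \<in> V \<Longrightarrow> \<exists>e\<in>E. w \<in> e"
    using hyp by (auto simp: hypergraph_def)
  have finE: "finite E" using odd card.infinite by fastforce
  define C where "C = {w \<in> V. \<exists>vs es. walk V E vs es \<and> hd vs = u \<and> last vs = w}"
  have "walk V E [u] []" using u by (simp add: walk_def)
  then have uC: "u \<in> C" using u unfolding C_def by fastforce
  have step: "y \<in> C" if "x \<in> C" "e \<in> E" "x \<in> e" "y \<in> e" for x y e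
  proof -
    from that obtain vs es where ve: "walk V E vs es" "hd vs = u" "last vs = x"
      by (auto simp: C_def)
    have y: "y \<in> V" using that sub by blast
    have "walk V E (vs @ [y]) (es @ [e])"
      using walk_snoc[OF ve(1)] ve that y by blast
    moreover have "hd (vs @ [y]) = u" using ve by (cases vs) (auto simp: walk_def)
    ultimately show ?thesis using y unfolding C_def by fastforce
  qed
  define F where "F = {e \<in> E. e \<subseteq> C}"
  \<comment> \<open>A hyperedge meeting \<open>C\<close> lies inside \<open>C\<close>, so a single
    vertex decides membership in \<open>F\<close>.\<close>
  have FC: "e \<in> F \<longleftrightarrow> e \<in> E \<and> x \<in> C" if "x \<in> e" for x e
    using step that by (auto simp: F_def)
  have deg: "even (card {e \<in> H. x \<in> e})" if "x \<in> V" "H = F \<or> H = E - F" for x H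
  proof -
    have "{e \<in> H. x \<in> e} = {e \<in> E. x \<in> e} \<or> {e \<in> H. x \<in> e} = {}"
      using FC that(2) by blast
    moreover have "even (card {e \<in> E. x \<in> e})"
      using reg that(1) by (simp add: regular_def)
    ultimately show ?thesis by (elim disjE) (simp_all only: card.empty dvd_0_right)
  qed
  \<comment> \<open>Whichever of \<open>F\<close>, \<open>E - F\<close> has odd size is itself not odd-bipartite, so no edge lies outside it.\<close>
  have key: "E \<subseteq> H" if "H = F \<or> H = E - F" "odd (card H)" for H
  proof
    fix e assume e: "e \<in> E"
    have HE: "H \<subseteq> E" using that(1) by (auto simp: F_def)
    have "\<not> odd_bipartite V H"
    proof (rule odd_card_not_odd_bipartite[OF finV _ that(2)])
      show "finite H" using HE finE by (rule finite_subset)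
      show "d \<subseteq> V" if "d \<in> H" for d using that HE sub by blast
      show "even (card {d \<in> H. x \<in> d})" if "x \<in> V" for x
        using deg[OF that \<open>H = F \<or> H = E - F\<close>] .
    qed
    moreover obtain U where U: "U \<subseteq> V" "\<forall>d\<in>E - {e}. odd (card (d \<inter> U))"
      using min e unfolding minimal_non_odd_bipartite_def odd_bipartite_def by auto
    have "odd_bipartite V H" if "e \<notin> H"
      unfolding odd_bipartite_def
    proof (intro exI conjI ballI)
      show "odd (card (d \<inter> U))" if "d \<in> H" for d
        using U(2) that HE \<open>e \<notin> H\<close> by auto
    qed (rule U(1))
    ultimately show "e \<in> H" by blast
  qed
  have "F \<subseteq> E" by (auto simp: F_def)
  then have "card E = card F + card (E - F)"
    using finE by (metis card_Diff_subset card_mono finite_subset le_add_diff_inverse)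
  \<comment> \<open>Some hyperedge passes through \<open>u\<close> and hence lies in
    \<open>F\<close>.\<close>
  moreover have "\<not> E \<subseteq> E - F"
  proof -
    obtain e where "e \<in> E" "u \<in> e" using iso u by blast
    then show ?thesis using FC uC by blast
  qed
  ultimately have "E \<subseteq> F" using key[of F] key[of "E - F"] odd by fastforce
  moreover obtain e where "e \<in> E" "v \<in> e" using iso v by blast
  ultimately have "v \<in> C" by (auto simp: F_def)
  then show "\<exists>vs es. walk V E vs es \<and> hd vs = u \<and> last vs = v"
    by (auto simp: C_def)
qed

section \<open>Prescribing parities in a connected hypergraph\<close>

text \<open>The common part of \<open>A\<close> and \<open>B\<close> is counted twice and cancels,
  so parity patterns add modulo 2 under symmetric difference.\<close>

lemma even_card_Int_sym_diff:
  assumes "finite A" "finite B"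
  shows "even (card (e \<inter> ((A - B) \<union> (B - A)))) \<longleftrightarrow> (even (card (e \<inter> A)) \<longleftrightarrow> even (card (e \<inter> B)))"
proof -
  have A: "card (e \<inter> A) = card (e \<inter> (A - B)) + card (e \<inter> A \<inter> B)"
    using assms by (subst card_Un_disjoint[symmetric]) (auto intro!: arg_cong[where f = card])
  have B: "card (e \<inter> B) = card (e \<inter> (B - A)) + card (e \<inter> A \<inter> B)"
    using assms by (subst card_Un_disjoint[symmetric]) (auto intro!: arg_cong[where f = card])
  have "card (e \<inter> ((A - B) \<union> (B - A))) = card (e \<inter> (A - B)) + card (e \<inter> (B - A))"
    using assms by (subst card_Un_disjoint[symmetric]) (auto intro!: arg_cong[where f = card])
  then show ?thesis using A B by auto
qed

text \<open>A single vertex is odd on exactly its two hyperedges. Adding such sets modulo 2 along a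
  walk from \<open>d\<close> to \<open>e\<close> cancels the intermediate hyperedges; for
  \<open>d = e\<close> nothing stays odd.\<close>

lemma connected_odd_at_pair:
  assumes hyp: "hypergraph V E" and reg: "regular 2 V E" and conn: "hypergraph_connected V E"
    and "d \<in> E" "e \<in> E"
  shows "\<exists>U\<subseteq>V. \<forall>c\<in>E. odd (card (c \<inter> U)) \<longleftrightarrow> (c = d) \<noteq> (c = e)"
proof -
  have finV: "finite V" and sub: "\<And>e. e \<in> E \<Longrightarrow> e \<subseteq> V \<and> e \<noteq> {}"
    using hyp by (auto simp: hypergraph_def)
  define P where "P d e \<longleftrightarrow> (\<exists>U\<subseteq>V. \<forall>c\<in>E. odd (card (c \<inter> U)) \<longleftrightarrow> (c = d) \<noteq> (c = e))" for d e
  have adj: "P d e" if de: "d \<in> E" "e \<in> E" "x \<in> V" "x \<in> d" "x \<in> e" for d e x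
  proof (cases "d = e")
    case True
    then show ?thesis unfolding P_def by (intro exI[of _ "{}"]) auto
  next
    case False
    have "card {c \<in> E. x \<in> c} = 2" using reg de by (simp add: regular_def)
    then obtain p q where "{c \<in> E. x \<in> c} = {p, q}"
      by (auto simp: card_2_iff)
    moreover have "d \<in> {c \<in> E. x \<in> c}" "e \<in> {c \<in> E. x \<in> c}"
      using de by simp_all
    ultimately have "{c \<in> E. x \<in> c} = {d, e}"
      using False by (simp only: insert_iff empty_iff) blast
    then have "x \<in> c \<longleftrightarrow> c = d \<or> c = e" if "c \<in> E" for c
      using that by blast
    then have "odd (card (c \<inter> {x})) \<longleftrightarrow> (c = d) \<noteq> (c = e)" if "c \<in> E" for c
      using that False by (cases "x \<in> c") auto
    then show ?thesis unfolding P_def using de(3) by (intro exI[of _ "{x}"]) simp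
  qed
  have trans: "P d e" if "P d c" "P c e" for d c e
  proof -
    obtain A where A: "A \<subseteq> V" "\<forall>x\<in>E. odd (card (x \<inter> A)) \<longleftrightarrow> (x = d) \<noteq> (x = c)"
      using \<open>P d c\<close> unfolding P_def by (elim exE conjE)
    obtain B where B: "B \<subseteq> V" "\<forall>x\<in>E. odd (card (x \<inter> B)) \<longleftrightarrow> (x = c) \<noteq> (x = e)"
      using \<open>P c e\<close> unfolding P_def by (elim exE conjE)
    have "finite A" "finite B" using A(1) B(1) finV by (auto intro: finite_subset)
    then have "odd (card (x \<inter> ((A - B) \<union> (B - A)))) \<longleftrightarrow> (x = d) \<noteq> (x = e)" if "x \<in> E" for x
      using bspec[OF A(2) that] bspec[OF B(2) that] by (simp only: even_card_Int_sym_diff) blast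
    moreover have "(A - B) \<union> (B - A) \<subseteq> V" using A(1) B(1) by blast
    ultimately show ?thesis unfolding P_def by blast
  qed
  obtain u v where uv: "u \<in> d" "v \<in> e" "u \<in> V" "v \<in> V" using sub assms(4,5) by blast
  then obtain vs es where w: "walk V E vs es" "hd vs = u" "last vs = v"
    using conn unfolding hypergraph_connected_def by meson
  have len: "length vs = Suc (length es)" and vsV: "set vs \<subseteq> V" and esE: "set es \<subseteq> E"
    and inc: "\<And>i. i < length es \<Longrightarrow> vs ! i \<in> es ! i \<and> vs ! Suc i \<in> es ! i"
    using w(1) by (auto simp: walk_def)
  \<comment> \<open>The claim covers every hyperedge through the current vertex, so it applies to
    the next one of the walk and, at the end, to \<open>e\<close>.\<close>
  have "\<forall>c\<in>E. vs ! i \<in> c \<longrightarrow> P d c" if "i \<le> length es" for i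
    using that
  proof (induction i)
    case 0
    have "vs ! 0 = u" using w(2) len by (metis hd_conv_nth length_0_conv nat.distinct(1))
    then show ?case using adj assms(4) uv by blast
  next
    case (Suc i)
    then have i: "es ! i \<in> E" "vs ! i \<in> es ! i" "vs ! Suc i \<in> es ! i" "vs ! Suc i \<in> V"
      using inc[of i] esE vsV len by auto
    then have "P d (es ! i)" using Suc by auto
    then show ?case using adj[OF i(1) _ i(4,3)] trans by blast
  qed
  moreover have "vs ! length es = v"
    using w(3) len by (metis diff_Suc_1 last_conv_nth length_0_conv nat.distinct(1))
  ultimately have "P d e" using assms(5) uv by blast
  then show ?thesis by (simp add: P_def)
qed

text \<open>Every parity pattern \<open>F\<close> on \<open>E - {e}\<close> can be realised, in
  particular the all-odd one. A new member \<open>d\<close> is switched on jointly with a change at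
  \<open>e\<close>, which is invisible after the deletion.\<close>

lemma connected_imp_odd_bipartite_Diff:
  assumes hyp: "hypergraph V E" and reg: "regular 2 V E" and conn: "hypergraph_connected V E"
    and fin: "finite E" and e: "e \<in> E"
  shows "odd_bipartite V (E - {e})"
proof -
  have finV: "finite V" using hyp by (auto simp: hypergraph_def)
  have "\<exists>U\<subseteq>V. \<forall>c\<in>E - {e}. odd (card (c \<inter> U)) \<longleftrightarrow> c \<in> F" if "finite F" "F \<subseteq> E - {e}" for F
    using that
  proof (induction F rule: finite_induct)
    case empty
    then show ?case by (intro exI[of _ "{}"]) auto
  next
    case (insert d F)
    then obtain A where A: "A \<subseteq> V" "\<And>c. c \<in> E - {e} \<Longrightarrow> odd (card (c \<inter> A)) \<longleftrightarrow> c \<in> F"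
      by auto
    obtain B where B: "B \<subseteq> V" "\<And>c. c \<in> E \<Longrightarrow> odd (card (c \<inter> B)) \<longleftrightarrow> (c = d) \<noteq> (c = e)"
      using connected_odd_at_pair[OF hyp reg conn, of d e] insert.prems e by auto
    have "finite A" "finite B" using A(1) B(1) finV by (auto intro: finite_subset)
    then have "odd (card (c \<inter> ((A - B) \<union> (B - A)))) \<longleftrightarrow> c \<in> insert d F" if "c \<in> E - {e}" for c
      using A(2)[OF that] B(2)[of c] that insert.hyps(2)
      by (simp only: even_card_Int_sym_diff) blast
    moreover have "(A - B) \<union> (B - A) \<subseteq> V" using A(1) B(1) by blast
    ultimately show ?case by blast
  qed
  from this[of "E - {e}"] fin show ?thesis
    by (auto simp: odd_bipartite_def)
qed

theorem theorem4p6: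
  fixes V :: "'a set" and E :: "'a set set" and k m n :: nat
  assumes "k \<ge> 4" and "even k"
    and "hypergraph V E"
    and "regular 2 V E" and "uniform k E"
    and "card V = n" and "card E = m" and "odd m"
  shows "minimal_non_odd_bipartite V E \<longleftrightarrow>
    hypergraph_connected V E \<and>
    (\<exists>V' E'. constructed k m n V' E' \<and> hypergraph_isomorphic V E V' E')"
proof -
  have odd: "odd (card E)" using assms by simp
  then have fin: "finite E" using card.infinite by fastforce
  \<comment> \<open>All degrees are 2 and the number of hyperedges is odd.\<close>
  have "\<not> odd_bipartite V E"
    using assms(3,4) odd fin
    by (intro odd_card_not_odd_bipartite) (auto simp: hypergraph_def regular_def)
  then have "minimal_non_odd_bipartite V E \<longleftrightarrow> hypergraph_connected V E"
    using minimal_non_odd_bipartite_imp_connected[OF assms(3,4) odd]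
      connected_imp_odd_bipartite_Diff[OF assms(3,4) _ fin]
    by (auto simp: minimal_non_odd_bipartite_def)
  moreover have "\<exists>V' E'. constructed k m n V' E' \<and> hypergraph_isomorphic V E V' E'"
    using regular_2_isomorphic_constructed[of k V E n m] assms by simp
  ultimately show ?thesis by blast
qed

end
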